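(* Let $\mathfrak W=\{w_k\}_{k\ge 0}$ be a system of continuous complex-valued functions on $\mathbb T$ satisfying the standing assumptions and properties (P1)--(P3) of the context, let $n\ge 0$, let $c_0\in\mathbb R$, $c_1,\dots,c_n\in\mathbb C$, put $c_{-s}=\overline{c_s}$, and for $0\le j,k\le n$ define $$c_{jk}=\sum_{s=-j}^{k}\beta_{jk,s}\,c_s ,$$ where the $\beta_{jk,s}$ are the coefficients of property (P2). Then the following assertions are equivalent: (1) the matrix $C=[c_{jk}]_{j,k=0,\dots,n}$ is positive semidefinite, $C\ge 0$ (i.e. $C$ is a generalized Toeplitz matrix w.r.t. $\mathfrak W$); (2) the sequence $\{c_k\}_{k=0,\dots,n}$ is positive w.r.t. $\mathfrak W$: for all $a_0,\dots,a_n\in\mathbb C$, if $\sum_{k=0}^n (a_kw_k+\overline{a_kw_k})\ge 0$ on $\mathbb T$, then $\sum_{k=0}^n(a_kc_k+\overline{a_kc_k})\ge 0$; (3) there is a positive finite Borel measure $\sigma$ on $\mathbb T$ such that $c_{jk}=\int_{\mathbb T}\overline{w_j}\,w_k\,d\sigma$ for all $0\le j,k\le n$; (3') there is a positive finite Borel measure $\sigma$ on $\mathbb T$ such that $c_k=\int_{\mathbb T}w_k\,d\sigma$ for all $0\le k\le n$.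
   Context: $\mathbb T=\{z\in\mathbb C:|z|=1\}$. For a system $\mathfrak W=\{w_k\}_{k\ge0}$ of continuous functions $w_k:\mathbb T\to\mathbb C$ put $w_{-k}=\overline{w_k}$, and let $\mathcal L_n$ be the complex linear span of $w_0,\dots,w_n$ and $\overline{\mathcal L}_n=\{\overline f: f\in\mathcal L_n\}$. Standing assumptions: the functions $\{w_k\}_{k\ge 0}\cup\{\overline{w_k}\}_{k\ge 1}$ are linearly independent over $\mathbb C$, and (P1) $w_0=1$. (P2) For all $j,k\ge 0$ one has $\overline{w_j}w_k\in\overline{\mathcal L}_j+\mathcal L_k$, i.e. $\overline{w_j}w_k=\sum_{s=-j}^{k}\beta_{jk,s}w_s$ for some complex coefficients $\beta_{jk,s}$ (uniquely determined by $\mathfrak W$). (P3) (Factorization) For every $n\ge0$ and $a_0,\dots,a_n\in\mathbb C$: if $\sum_{k=0}^n(a_kw_k+\overline{a_kw_k})\ge0$ on $\mathbb T$, then there are $b_0,\dots,b_n\in\mathbb C$ with $\sum_{k=0}^n(a_kw_k+\overline{a_kw_k})=\left|\sum_{k=0}^n b_kw_k\right|^2$ on $\mathbb T$. A Hermitian positive semidefinite matrix $[c_{jk}]_{j,k=0,\dots,n}$ is called a generalized Toeplitz matrix w.r.t. $\mathfrak W$ if its entries satisfy $c_{jk}=\sum_{s=-j}^{k}\beta_{jk,s}c_s$ with $c_k=c_{0k}$, $c_{-s}=\overline{c_s}$. *)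

theory Defs
  imports "HOL-Analysis.Analysis"
begin

(* A function on the unit circle is a function on the complex numbers of which only the values
   on the circle matter. *)
abbreviation unit_circle :: "complex set" where
  "unit_circle \<equiv> sphere 0 1"

(* Extension of x_0, x_1, ... to negative indices by x_{-k} = cnj x_k. It serves both the
   numbers c_k and, pointwise, the functions w_k. At index 0 the value is x_0 itself, which
   agrees with the convention exactly when x_0 is real. *)
definition conj_ext :: "(nat \<Rightarrow> complex) \<Rightarrow> int \<Rightarrow> complex" where
  "conj_ext x s = (if 0 \<le> s then x (nat s) else cnj (x (nat (- s))))"

definition lin_span :: "(nat \<Rightarrow> complex \<Rightarrow> complex) \<Rightarrow> nat \<Rightarrow> (complex \<Rightarrow> complex) set" where
  "lin_span w n = {(\<lambda>z. \<Sum>k\<le>n. a k * w k z) | a. True}"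

(* Linear independence over the complex numbers, as functions on the circle, of the family
   consisting of w_k (k >= 0) and cnj w_k (k >= 1). *)
definition conj_independent :: "(nat \<Rightarrow> complex \<Rightarrow> complex) \<Rightarrow> bool" where
  "conj_independent w \<longleftrightarrow>
     (\<forall>S (a :: int \<Rightarrow> complex). finite S \<longrightarrow>
        (\<forall>z\<in>unit_circle. (\<Sum>s\<in>S. a s * conj_ext (\<lambda>k. w k z) s) = 0) \<longrightarrow> (\<forall>s\<in>S. a s = 0))"

definition product_property :: "(nat \<Rightarrow> complex \<Rightarrow> complex) \<Rightarrow> bool" where
  "product_property w \<longleftrightarrow>
     (\<forall>j k. \<exists>f\<in>lin_span w j. \<exists>g\<in>lin_span w k.
        \<forall>z\<in>unit_circle. cnj (w j z) * w k z = cnj (f z) + g z)"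

(* beta j k s is only constrained for -j <= s <= k; there it is determined by w if
   conj_independent w holds. *)
definition product_coeffs ::
    "(nat \<Rightarrow> complex \<Rightarrow> complex) \<Rightarrow> (nat \<Rightarrow> nat \<Rightarrow> int \<Rightarrow> complex) \<Rightarrow> bool" where
  "product_coeffs w \<beta> \<longleftrightarrow>
     (\<forall>j k. \<forall>z\<in>unit_circle.
        cnj (w j z) * w k z = (\<Sum>s = - int j..int k. \<beta> j k s * conj_ext (\<lambda>i. w i z) s))"

(* Below, 0 <= x for complex x is the library's order: x is real and nonnegative. *)

definition factorization_property :: "(nat \<Rightarrow> complex \<Rightarrow> complex) \<Rightarrow> bool" where
  "factorization_property w \<longleftrightarrow>
     (\<forall>n a. (\<forall>z\<in>unit_circle. 0 \<le> (\<Sum>k\<le>n. a k * w k z + cnj (a k * w k z))) \<longrightarrow>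
        (\<exists>b. \<forall>z\<in>unit_circle.
           (\<Sum>k\<le>n. a k * w k z + cnj (a k * w k z)) =
             complex_of_real ((cmod (\<Sum>k\<le>n. b k * w k z))\<^sup>2)))"

definition gen_toeplitz_entry ::
    "(nat \<Rightarrow> nat \<Rightarrow> int \<Rightarrow> complex) \<Rightarrow> (nat \<Rightarrow> complex) \<Rightarrow> nat \<Rightarrow> nat \<Rightarrow> complex" where
  "gen_toeplitz_entry \<beta> c j k = (\<Sum>s = - int j..int k. \<beta> j k s * conj_ext c s)"

(* The matrix is [A j k] with 0 <= j, k <= n. *)
definition pos_semidef :: "nat \<Rightarrow> (nat \<Rightarrow> nat \<Rightarrow> complex) \<Rightarrow> bool" where
  "pos_semidef n A \<longleftrightarrow>
     (\<forall>j\<le>n. \<forall>k\<le>n. A k j = cnj (A j k)) \<and>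
     (\<forall>x :: nat \<Rightarrow> complex. 0 \<le> (\<Sum>j\<le>n. \<Sum>k\<le>n. cnj (x j) * A j k * x k))"

definition positive_seq :: "(nat \<Rightarrow> complex \<Rightarrow> complex) \<Rightarrow> nat \<Rightarrow> (nat \<Rightarrow> complex) \<Rightarrow> bool" where
  "positive_seq w n c \<longleftrightarrow>
     (\<forall>a. (\<forall>z\<in>unit_circle. 0 \<le> (\<Sum>k\<le>n. a k * w k z + cnj (a k * w k z))) \<longrightarrow>
        0 \<le> (\<Sum>k\<le>n. a k * c k + cnj (a k * c k)))"

definition finite_circle_measure :: "complex measure \<Rightarrow> bool" where
  "finite_circle_measure \<sigma> \<longleftrightarrow>
     finite_measure \<sigma> \<and> sets \<sigma> = sets (restrict_space borel unit_circle)"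

end

theory Submission
  imports Defs
begin

text \<open>
  The implications form a cycle, from (1) to (2), (3'), (3) and back to (1).
  Under (P3) a nonnegative \<open>\<Sum> (a\<^sub>k w\<^sub>k + cnj (a\<^sub>k w\<^sub>k))\<close> is \<open>|\<Sum> b\<^sub>k w\<^sub>k|\<^sup>2\<close>; expanding the
  square by (P2) and comparing coefficients, the value of the functional given by \<open>c\<close> is the
  quadratic form of the matrix at \<open>b\<close>, so (1) implies (2).
  For a positive sequence, \<open>(c\<^sub>0, ..., c\<^sub>n)\<close> lies in the convex cone generated by the compact curve
  \<open>z \<mapsto> (w\<^sub>0 z, ..., w\<^sub>n z)\<close>, because this cone is closed (since \<open>w\<^sub>0 = 1\<close>) and a point outside
  could be separated from it; this gives a representing measure with finite support.
  The other two implications are integrations of (P2) and of \<open>|\<Sum> x\<^sub>k w\<^sub>k|\<^sup>2\<close>.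
\<close>

section \<open>Convex cones in finite dimension: reducing the number of generators, nearest points,
  separation\<close>

lemma nontrivial_linear_relation:
  fixes v :: "'i \<Rightarrow> 'z \<Rightarrow> real"
  assumes "finite I" "finite Z" "card I < card Z"
  shows "\<exists>s. (\<exists>z\<in>Z. s z \<noteq> 0) \<and> (\<forall>i\<in>I. (\<Sum>z\<in>Z. s z * v i z) = 0)"
  using assms
proof (induction I arbitrary: Z v rule: finite_induct)
  case empty
  then have "Z \<noteq> {}" by auto
  then show ?case by (intro exI[of _ "\<lambda>_. 1"]) auto
next
  case (insert i I)
  show ?case
  proof (cases "\<forall>z\<in>Z. v i z = 0")
    case True
    obtain s where "\<exists>z\<in>Z. s z \<noteq> 0" "\<forall>j\<in>I. (\<Sum>z\<in>Z. s z * v j z) = 0"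
      using insert.IH[of Z v] insert.prems insert.hyps by auto
    with True show ?thesis by (intro exI[of _ s]) auto
  next
    case False
    then obtain y where y: "y \<in> Z" "v i y \<noteq> 0" by blast
    define Y where "Y = Z - {y}"
    have Y: "finite Y" "y \<notin> Y" "Z = insert y Y" using insert.prems y by (auto simp: Y_def)
    have "card I < card Y" using insert.prems insert.hyps Y by simp
    \<comment> \<open>Gaussian elimination with pivot \<open>v i y\<close>: from the vector at
      \<open>z\<close> the multiple of the vector at \<open>y\<close> is subtracted that cancels
      coordinate \<open>i\<close>. One vector and one coordinate fewer remain.\<close>
    from insert.IH[OF Y(1) this, of "\<lambda>j z. v j z - v i z / v i y * v j y"]
    obtain s where s: "\<exists>z\<in>Y. s z \<noteq> 0"
      "\<And>j. j \<in> I \<Longrightarrow> (\<Sum>z\<in>Y. s z * (v j z - v i z / v i y * v j y)) = 0" by blast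
    \<comment> \<open>The subtracted multiples of the vector at \<open>y\<close> are collected into
      its weight \<open>- \<alpha>\<close>. The same choice makes the relation hold in coordinate
      \<open>i\<close>.\<close>
    define \<alpha> where "\<alpha> = (\<Sum>z\<in>Y. s z * v i z) / v i y"
    define s' where "s' = s(y := - \<alpha>)"
    have split: "(\<Sum>z\<in>Z. s' z * v j z) = - \<alpha> * v j y + (\<Sum>z\<in>Y. s z * v j z)" for j
    proof -
      have "(\<Sum>z\<in>Y. s' z * v j z) = (\<Sum>z\<in>Y. s z * v j z)"
        using Y by (intro sum.cong) (auto simp: s'_def)
      then show ?thesis using Y by (simp add: s'_def)
    qed
    have "(\<Sum>z\<in>Z. s' z * v j z) = 0" if "j \<in> I" for j
    proof -
      have "0 = (\<Sum>z\<in>Y. s z * v j z) - (\<Sum>z\<in>Y. s z * v i z) / v i y * v j y"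
        using s(2)[OF that] by (simp add: algebra_simps sum_subtractf sum_distrib_left sum_divide_distrib)
      then show ?thesis unfolding split \<alpha>_def by simp
    qed
    moreover have "(\<Sum>z\<in>Z. s' z * v i z) = 0" unfolding split \<alpha>_def using y by simp
    moreover have "\<exists>z\<in>Z. s' z \<noteq> 0" using s(1) Y by (auto simp: s'_def)
    ultimately show ?thesis by (intro exI[of _ s']) auto
  qed
qed

text \<open>The reduction step of Caratheodory's theorem for cones: moving the weights along a
  linear relation does not change the combination, and the move is stopped when the first weight
  reaches zero.\<close>

lemma conic_combination_drop_term:
  fixes v :: "'i \<Rightarrow> 'z \<Rightarrow> real"
  assumes "finite I" "finite Z" "card I < card Z" and t: "\<And>z. t z \<ge> 0"
  shows "\<exists>u. (\<forall>z. u z \<ge> 0) \<and> (\<exists>z\<in>Z. u z = 0) \<and>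
    (\<forall>i\<in>I. (\<Sum>z\<in>Z. u z * v i z) = (\<Sum>z\<in>Z. t z * v i z))"
proof -
  obtain s0 y0 where s0: "y0 \<in> Z" "s0 y0 \<noteq> 0" "\<forall>i\<in>I. (\<Sum>z\<in>Z. s0 z * v i z) = 0"
    using nontrivial_linear_relation[OF assms(1-3)] by blast
  \<comment> \<open>The sign is normalized so that \<open>s\<close> is positive somewhere; only such
    weights decrease when a multiple of \<open>s\<close> is subtracted.\<close>
  define s where "s z = sgn (s0 y0) * s0 z" for z
  have s: "s y0 > 0" using s0 by (simp add: s_def sgn_if)
  have rel: "(\<Sum>z\<in>Z. s z * v i z) = 0" if "i \<in> I" for i
    using s0(3) that by (simp add: s_def mult.assoc sum_distrib_left[symmetric])
  let ?P = "{z\<in>Z. s z > 0}"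
  have P: "finite ?P" "?P \<noteq> {}" using assms s s0 by auto
  \<comment> \<open>The least ratio \<open>t z / s z\<close> is the largest multiple of
    \<open>s\<close> that can be subtracted with all weights staying nonnegative; it makes the
    weight at \<open>y\<close> vanish.\<close>
  define y where "y = arg_min_on (\<lambda>z. t z / s z) ?P"
  have y: "y \<in> ?P" "\<And>z. z \<in> ?P \<Longrightarrow> t y / s y \<le> t z / s z"
    unfolding y_def
    by (rule arg_min_if_finite(1)[OF P]) (rule arg_min_least[OF P, of _ "\<lambda>z. t z / s z"])
  define u where "u z = (if z \<in> Z then t z - t y / s y * s z else t z)" for z
  have "u z \<ge> 0" for z
  proof (cases "z \<in> Z \<and> s z > 0")
    case True
    then have "t y / s y \<le> t z / s z" using y by auto
    then have "t y / s y * s z \<le> t z" using True by (simp add: pos_le_divide_eq)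
    then show ?thesis using True by (simp add: u_def)
  next
    case False
    have "0 \<le> t y / s y" using t y by auto
    then have "t y / s y * s z \<le> 0" if "s z \<le> 0" using that by (rule mult_nonneg_nonpos)
    with False t[of z] show ?thesis by (auto simp: u_def)
  qed
  moreover have "y \<in> Z" "u y = 0" using y by (auto simp: u_def)
  moreover have "(\<Sum>z\<in>Z. u z * v i z) = (\<Sum>z\<in>Z. t z * v i z)" if "i \<in> I" for i
  proof -
    have "(\<Sum>z\<in>Z. u z * v i z) = (\<Sum>z\<in>Z. t z * v i z - t y / s y * (s z * v i z))"
      by (intro sum.cong) (auto simp: u_def algebra_simps)
    then show ?thesis using rel[OF that] by (simp only: sum_subtractf sum_distrib_left[symmetric] mult_zero_right diff_zero)
  qed
  ultimately show ?thesis by blast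
qed

text \<open>First-order condition at a minimum: the squared distance after a step
  \<open>\<epsilon>\<close> along \<open>y\<close> has derivative
  \<open>-2 * (\<Sum>i\<in>I. r i * y i)\<close> at 0, so a positive inner product would allow a
  short step that decreases it.\<close>

lemma inner_nonpos_of_nearest:
  fixes r y :: "'i \<Rightarrow> real"
  assumes min: "\<And>\<epsilon>. 0 < \<epsilon> \<Longrightarrow> \<epsilon> \<le> 1 \<Longrightarrow> (\<Sum>i\<in>I. (r i)\<^sup>2) \<le> (\<Sum>i\<in>I. (r i - \<epsilon> * y i)\<^sup>2)"
  shows "(\<Sum>i\<in>I. r i * y i) \<le> 0"
proof (rule ccontr)
  assume contra: "\<not> ?thesis"
  define a where "a = (\<Sum>i\<in>I. r i * y i)"
  define b where "b = (\<Sum>i\<in>I. (y i)\<^sup>2)"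
  have a: "a > 0" using contra by (simp add: a_def)
  have b: "b \<ge> 0" by (simp add: b_def sum_nonneg)
  \<comment> \<open>Short enough for \<open>\<epsilon> * b \<le> a\<close>, so that the linear gain
    \<open>2 * \<epsilon> * a\<close> exceeds the quadratic loss; \<open>b + 1\<close> keeps the
    denominator positive when \<open>b = 0\<close>.\<close>
  define \<epsilon> where "\<epsilon> = min 1 (a / (b + 1))"
  have \<epsilon>: "0 < \<epsilon>" "\<epsilon> \<le> 1" using a b by (auto simp: \<epsilon>_def)
  have "(\<Sum>i\<in>I. (r i - \<epsilon> * y i)\<^sup>2) = (\<Sum>i\<in>I. (r i)\<^sup>2 - 2 * \<epsilon> * (r i * y i) + \<epsilon>\<^sup>2 * (y i)\<^sup>2)"
    by (intro sum.cong) (auto simp: power2_eq_square algebra_simps)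
  also have "\<dots> = (\<Sum>i\<in>I. (r i)\<^sup>2) - 2 * \<epsilon> * a + \<epsilon>\<^sup>2 * b"
    by (simp only: sum.distrib sum_subtractf sum_distrib_left[symmetric] a_def b_def)
  finally have "2 * \<epsilon> * a \<le> \<epsilon>\<^sup>2 * b" using min[OF \<epsilon>] by linarith
  then have "2 * a \<le> \<epsilon> * b" using \<epsilon> by (simp add: power2_eq_square)
  moreover have "\<epsilon> * b \<le> \<epsilon> * (b + 1)" using \<epsilon> by simp
  moreover have "\<epsilon> * (b + 1) \<le> a"
  proof -
    have "\<epsilon> \<le> a / (b + 1)" by (simp add: \<epsilon>_def)
    then show ?thesis using b by (simp add: pos_le_divide_eq)
  qed
  ultimately show False using a by linarith
qed

text \<open>The coordinate \<open>i0\<close>, constantly 1 on \<open>K\<close>, records the sum of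
  the weights. A combination at least as near to \<open>c\<close> as 0 therefore has bounded
  weights, and the minimum is sought over a compact set of weights and points.\<close>

lemma nearest_conic_combination:
  fixes K :: "'a::topological_space set" and v :: "'i \<Rightarrow> 'a \<Rightarrow> real" and c :: "'i \<Rightarrow> real" and N :: nat
  assumes K: "compact K" "K \<noteq> {}" and I: "finite I"
    and cont: "\<And>i. i \<in> I \<Longrightarrow> continuous_on K (v i)"
    and unit: "i0 \<in> I" "\<And>z. z \<in> K \<Longrightarrow> v i0 z = 1"
  defines "G \<equiv> \<lambda>t p. \<Sum>i\<in>I. (c i - (\<Sum>l\<le>N. t l * v i (p l)))\<^sup>2"
  shows "\<exists>t p. (\<forall>l. 0 \<le> t l \<and> p l \<in> K) \<and>
    (\<forall>t' p'. (\<forall>l. 0 \<le> t' l \<and> p' l \<in> K) \<longrightarrow> G t p \<le> G t' p')"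
proof -
  define M where "M = (\<Sum>i\<in>I. (c i)\<^sup>2)"
  \<comment> \<open>If the squared distance is at most \<open>M\<close>, coordinate
    \<open>i0\<close> alone shows that the sum of the weights differs from \<open>c i0\<close> by at
    most \<open>sqrt M\<close>.\<close>
  define R where "R = c i0 + sqrt M"
  have "(c i0)\<^sup>2 \<le> M" unfolding M_def by (rule member_le_sum[OF unit(1) _ I]) simp
  then have R: "R \<ge> 0" using real_le_rsqrt[of "- c i0" M] by (simp add: R_def)
  obtain x0 where x0: "x0 \<in> K" using K by blast
  define D where "D = PiE (UNIV :: nat set) (\<lambda>_. {0..R} \<times> K)"
  \<comment> \<open>Tychonoff; only the first \<open>N + 1\<close> coordinates matter\<close>
  have cD: "compact D"
  proof -
    have "compactin (product_topology (\<lambda>_. euclidean) UNIV) D"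
      unfolding D_def compactin_PiE using K by (auto simp: compact_Times)
    then show ?thesis by (simp add: euclidean_product_topology)
  qed
  have "(\<lambda>_. (0, x0)) \<in> D" using R x0 by (auto simp: D_def)
  then have neD: "D \<noteq> {}" by blast
  have mem: "q l \<in> {0..R} \<times> K" if "q \<in> D" for q l
    using that unfolding D_def by (rule PiE_mem) simp
  have coord: "continuous_on D (\<lambda>q. q l)" for l
    by (rule continuous_on_product_then_coordinatewise[OF continuous_on_id])
  have cont': "continuous_on D (\<lambda>q. v i (snd (q l)))" if "i \<in> I" for i l
  proof (rule continuous_on_compose2[OF cont[OF that]])
    show "continuous_on D (\<lambda>q. snd (q l))" by (rule continuous_on_snd[OF coord])
    show "(\<lambda>q. snd (q l)) ` D \<subseteq> K" using mem by (auto simp: mem_Times_iff)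
  qed
  have "continuous_on D (\<lambda>q. G (\<lambda>l. fst (q l)) (\<lambda>l. snd (q l)))"
    unfolding G_def
    by (intro continuous_on_sum continuous_on_power continuous_on_diff continuous_on_mult
        continuous_on_const continuous_on_fst coord cont')
  from continuous_attains_inf[OF cD neD this] obtain q where q: "q \<in> D"
    "\<And>q'. q' \<in> D \<Longrightarrow> G (\<lambda>l. fst (q l)) (\<lambda>l. snd (q l)) \<le> G (\<lambda>l. fst (q' l)) (\<lambda>l. snd (q' l))" by blast
  let ?t = "\<lambda>l. fst (q l)" and ?p = "\<lambda>l. snd (q l)"
  have adm: "0 \<le> ?t l \<and> ?p l \<in> K" for l using mem[OF q(1), of l] by (simp add: mem_Times_iff)
  \<comment> \<open>The minimizer is compared with the combination whose weights are all 0, at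
    squared distance \<open>M\<close>.\<close>
  have G0: "G ?t ?p \<le> M"
    using q(2)[OF \<open>(\<lambda>_. (0, x0)) \<in> D\<close>] by (simp add: G_def M_def)
  have "G ?t ?p \<le> G t' p'" if t': "\<forall>l. 0 \<le> t' l \<and> p' l \<in> K" for t' p'
  proof (cases "G t' p' \<le> M")
    case False
    then show ?thesis using G0 by simp
  next
    case True
    have "(c i0 - (\<Sum>l\<le>N. t' l * v i0 (p' l)))\<^sup>2 \<le> G t' p'"
      unfolding G_def
      by (rule member_le_sum[OF unit(1) _ I]) simp
    then have "((\<Sum>l\<le>N. t' l) - c i0)\<^sup>2 \<le> M"
      using True unit(2) t' by (simp add: power2_commute)
    then have sum: "(\<Sum>l\<le>N. t' l) \<le> R" using real_le_rsqrt[of "(\<Sum>l\<le>N. t' l) - c i0" M] by (simp add: R_def)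
    have le: "t' l \<le> R" if "l \<le> N" for l
      using member_le_sum[of l "{..N}" t'] that t' sum by simp
    \<comment> \<open>Beyond \<open>N\<close> the competitor is replaced by a default pair, since
      its later weights may exceed \<open>R\<close>; \<open>G\<close> does not see them.\<close>
    define q' where "q' l = (if l \<le> N then (t' l, p' l) else (0, x0))" for l
    have "q' \<in> D" using le t' R x0 by (auto simp: D_def q'_def)
    from q(2)[OF this] have "G ?t ?p \<le> G (\<lambda>l. fst (q' l)) (\<lambda>l. snd (q' l))" .
    also have "\<dots> = G t' p'" by (simp add: G_def q'_def)
    finally show ?thesis .
  qed
  with adm show ?thesis by (intro exI[of _ ?t] exI[of _ ?p]) blast
qed

text \<open>Among all conic combinations of \<open>N + 1\<close> points, take a nearest one \<open>x\<close> to \<open>c\<close>. If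
  \<open>N\<close> is the dimension, one of its weights can be made zero, so that any further point of \<open>K\<close>
  can be added without exceeding \<open>N + 1\<close> points. Hence \<open>c - x\<close> has nonpositive inner product
  with the curve, and positivity of \<open>c\<close> gives \<open>c = x\<close>.\<close>

lemma conic_combination_of_positive:
  fixes K :: "'a::topological_space set" and v :: "'i \<Rightarrow> 'a \<Rightarrow> real"
  assumes K: "compact K" "K \<noteq> {}" and I: "finite I"
    and cont: "\<And>i. i \<in> I \<Longrightarrow> continuous_on K (v i)"
    and unit: "i0 \<in> I" "\<And>z. z \<in> K \<Longrightarrow> v i0 z = 1"
    and pos: "\<And>a. (\<And>z. z \<in> K \<Longrightarrow> 0 \<le> (\<Sum>i\<in>I. a i * v i z)) \<Longrightarrow> 0 \<le> (\<Sum>i\<in>I. a i * c i)"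
  shows "\<exists>(N::nat) t p. (\<forall>l. 0 \<le> t l \<and> p l \<in> K) \<and> (\<forall>i\<in>I. c i = (\<Sum>l\<le>N. t l * v i (p l)))"
proof -
  define N where "N = card I"
  obtain t p where adm: "\<And>l. 0 \<le> t l" "\<And>l. p l \<in> K" and
    min: "\<And>t' p'. (\<forall>l. 0 \<le> t' l \<and> p' l \<in> K) \<Longrightarrow>
      (\<Sum>i\<in>I. (c i - (\<Sum>l\<le>N. t l * v i (p l)))\<^sup>2) \<le> (\<Sum>i\<in>I. (c i - (\<Sum>l\<le>N. t' l * v i (p' l)))\<^sup>2)"
    using nearest_conic_combination[where v = v and c = c and N = N, OF K I cont unit] by blast
  \<comment> \<open>There are \<open>N + 1\<close> indices and only \<open>N\<close> coordinates,
    just enough to free one index \<open>m\<close>. Indices rather than points are counted, so the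
    points \<open>p l\<close> may coincide.\<close>
  obtain u m where u: "\<And>l. 0 \<le> u l" "m \<le> N" "u m = 0"
    "\<And>i. i \<in> I \<Longrightarrow> (\<Sum>l\<le>N. u l * v i (p l)) = (\<Sum>l\<le>N. t l * v i (p l))"
    using conic_combination_drop_term[OF I, of "{..N}" t "\<lambda>i l. v i (p l)"] adm
    by (auto simp: N_def) blast
  define x where "x i = (\<Sum>l\<le>N. u l * v i (p l))" for i
  define r where "r i = c i - x i" for i
  have min': "(\<Sum>i\<in>I. (r i)\<^sup>2) \<le> (\<Sum>i\<in>I. (c i - (\<Sum>l\<le>N. t' l * v i (p' l)))\<^sup>2)"
    if "\<forall>l. 0 \<le> t' l \<and> p' l \<in> K" for t' p'
  proof -
    have "(\<Sum>i\<in>I. (r i)\<^sup>2) = (\<Sum>i\<in>I. (c i - (\<Sum>l\<le>N. t l * v i (p l)))\<^sup>2)"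
      using u(4) by (intro sum.cong) (auto simp: r_def x_def)
    with min[OF that] show ?thesis by simp
  qed
  have neg: "(\<Sum>i\<in>I. r i * v i z) \<le> 0" if z: "z \<in> K" for z
  proof (rule inner_nonpos_of_nearest)
    fix \<epsilon> :: real assume "0 < \<epsilon>"
    have "(\<Sum>l\<le>N. (u(m := \<epsilon>)) l * v i ((p(m := z)) l)) = \<epsilon> * v i z + x i" for i
    proof -
      have "{..N} = insert m ({..N} - {m})" using u by auto
      then have split: "sum f {..N} = f m + sum f ({..N} - {m})" for f :: "nat \<Rightarrow> real"
        using u(2) by (subst sum.remove[of _ m]) auto
      have "(\<Sum>l\<in>{..N} - {m}. (u(m := \<epsilon>)) l * v i ((p(m := z)) l)) = (\<Sum>l\<in>{..N} - {m}. u l * v i (p l))"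
        by (intro sum.cong) auto
      then show ?thesis unfolding x_def split using u(3) by simp
    qed
    with min'[of "u(m := \<epsilon>)" "p(m := z)"] \<open>0 < \<epsilon>\<close> z u(1) adm
    show "(\<Sum>i\<in>I. (r i)\<^sup>2) \<le> (\<Sum>i\<in>I. (r i - \<epsilon> * v i z)\<^sup>2)"
      by (simp add: r_def algebra_simps)
  qed
  \<comment> \<open>Direction \<open>- x\<close> shrinks every weight by the factor
    \<open>1 - \<epsilon>\<close>, which remains admissible because
    \<open>\<epsilon> \<le> 1\<close>.\<close>
  have "(\<Sum>i\<in>I. r i * (- x i)) \<le> 0"
  proof (rule inner_nonpos_of_nearest)
    fix \<epsilon> :: real assume "0 < \<epsilon>" "\<epsilon> \<le> 1"
    have "(\<Sum>l\<le>N. (1 - \<epsilon>) * u l * v i (p l)) = (1 - \<epsilon>) * x i" for i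
      by (simp add: x_def sum_distrib_left mult.assoc)
    moreover have "\<forall>l. 0 \<le> (1 - \<epsilon>) * u l \<and> p l \<in> K" using \<open>\<epsilon> \<le> 1\<close> u(1) adm by simp
    ultimately have "(\<Sum>i\<in>I. (r i)\<^sup>2) \<le> (\<Sum>i\<in>I. (c i - (1 - \<epsilon>) * x i)\<^sup>2)"
      using min'[of "\<lambda>l. (1 - \<epsilon>) * u l" p] by simp
    then show "(\<Sum>i\<in>I. (r i)\<^sup>2) \<le> (\<Sum>i\<in>I. (r i - \<epsilon> * (- x i))\<^sup>2)"
      by (simp add: r_def algebra_simps)
  qed
  \<comment> \<open>The functional \<open>- r\<close> is nonnegative on the curve, so positivity
    bounds the inner product of \<open>r\<close> and \<open>c\<close> above by 0. Since
    \<open>r = c - x\<close>, both parts of the squared norm of \<open>r\<close> are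
    nonpositive.\<close>
  moreover have "0 \<le> (\<Sum>i\<in>I. (- r i) * c i)" using neg by (intro pos) (simp add: sum_negf)
  moreover have "(\<Sum>i\<in>I. (r i)\<^sup>2) = (\<Sum>i\<in>I. r i * (- x i)) - (\<Sum>i\<in>I. (- r i) * c i)"
    by (simp add: sum_subtractf[symmetric] r_def power2_eq_square algebra_simps)
  ultimately have "(\<Sum>i\<in>I. (r i)\<^sup>2) \<le> 0" by linarith
  then have "r i = 0" if "i \<in> I" for i
  proof -
    have "(r i)\<^sup>2 \<le> (\<Sum>i\<in>I. (r i)\<^sup>2)" by (rule member_le_sum[OF that _ I]) simp
    also note \<open>(\<Sum>i\<in>I. (r i)\<^sup>2) \<le> 0\<close>
    finally show ?thesis by simp
  qed
  then have "\<forall>i\<in>I. c i = (\<Sum>l\<le>N. u l * v i (p l))" by (simp add: r_def x_def)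
  with u adm show ?thesis by blast
qed

section \<open>Finite measures on the circle and integration of continuous functions\<close>

lemma discrete_circle_measure:
  fixes N :: nat
  assumes t: "\<And>l. 0 \<le> t l" and p: "\<And>l. p l \<in> unit_circle"
  shows "\<exists>\<sigma>. finite_circle_measure \<sigma> \<and>
    (\<forall>f :: complex \<Rightarrow> complex. continuous_on unit_circle f \<longrightarrow>
      (\<integral>z. f z \<partial>\<sigma>) = (\<Sum>l\<le>N. of_real (t l) * f (p l)))"
proof (intro exI conjI allI impI)
  \<comment> \<open>The masses are placed on the indices and pushed forward along \<open>p\<close>,
    so weights at coinciding points add up by themselves.\<close>
  define P where "P = point_measure {..N} (\<lambda>l. ennreal (t l))"
  define M :: "complex measure" where "M = restrict_space borel unit_circle"
  have meas: "p \<in> measurable P M"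
    using p by (auto simp: P_def M_def space_restrict_space)
  interpret finite_measure P
    by (rule finite_measureI) (simp add: P_def space_point_measure emeasure_point_measure_finite)
  show "finite_circle_measure (distr P M p)"
    using finite_measure_distr[OF meas] by (simp add: finite_circle_measure_def M_def)
  fix f :: "complex \<Rightarrow> complex" assume "continuous_on unit_circle f"
  then have "f \<in> borel_measurable M"
    unfolding M_def by (rule borel_measurable_continuous_on_restrict)
  then have "(\<integral>z. f z \<partial>distr P M p) = (\<integral>l. f (p l) \<partial>P)" by (rule integral_distr[OF meas])
  also have "\<dots> = (\<Sum>l\<le>N. of_real (t l) * f (p l))"
    unfolding P_def using t by (subst lebesgue_integral_point_measure_finite) (auto simp: scaleR_conv_of_real)
  finally show "(\<integral>z. f z \<partial>distr P M p) = (\<Sum>l\<le>N. of_real (t l) * f (p l))" .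
qed

lemma space_finite_circle_measure:
  assumes "finite_circle_measure \<sigma>"
  shows "space \<sigma> = unit_circle"
  using assms sets_eq_imp_space_eq[of \<sigma> "restrict_space borel unit_circle"]
  by (simp add: finite_circle_measure_def space_restrict_space)

lemma integrable_finite_circle_measure:
  fixes f :: "complex \<Rightarrow> complex"
  assumes \<sigma>: "finite_circle_measure \<sigma>" and f: "continuous_on unit_circle f"
  shows "integrable \<sigma> f"
proof -
  interpret finite_measure \<sigma> using \<sigma> by (simp add: finite_circle_measure_def)
  have "compact (f ` unit_circle)" by (rule compact_continuous_image[OF f compact_sphere])
  then have "bounded (f ` unit_circle)" by (rule compact_imp_bounded)
  then obtain B where "\<forall>y\<in>f ` unit_circle. norm y \<le> B" unfolding bounded_iff ..
  then have B: "norm (f z) \<le> B" if "z \<in> unit_circle" for z using that by simp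
  have sets: "sets \<sigma> = sets (restrict_space borel unit_circle)"
    using \<sigma> by (simp add: finite_circle_measure_def)
  have "f \<in> borel_measurable \<sigma>"
    by (subst measurable_cong_sets[OF sets refl]) (rule borel_measurable_continuous_on_restrict[OF f])
  with B show ?thesis
    by (intro integrable_const_bound[of f B] AE_I2) (simp_all add: space_finite_circle_measure[OF \<sigma>])
qed

section \<open>Comparison of coefficients, and positivity of the sequence from positivity of the
  matrix\<close>

lemma conj_independent_coeffs_eq:
  assumes "conj_independent w" "finite S"
    and "\<And>z. z \<in> unit_circle \<Longrightarrow>
      (\<Sum>s\<in>S. d s * conj_ext (\<lambda>i. w i z) s) = (\<Sum>s\<in>S. e s * conj_ext (\<lambda>i. w i z) s)"
    and "s \<in> S"
  shows "d s = e s"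
proof -
  have "\<forall>z\<in>unit_circle. (\<Sum>s\<in>S. (d s - e s) * conj_ext (\<lambda>i. w i z) s) = 0"
    using assms(3) by (simp add: left_diff_distrib sum_subtractf)
  then have "\<forall>s\<in>S. d s - e s = 0"
    using assms(1)[unfolded conj_independent_def, rule_format, of S "\<lambda>s. d s - e s"] assms(2) by auto
  with assms(4) show ?thesis by simp
qed

text \<open>Index 0 is special because \<open>x 0\<close> and its conjugate coincide for real
  \<open>x 0\<close>, so two terms of the symmetrized sum merge into one.\<close>

definition herm_coeff :: "(nat \<Rightarrow> complex) \<Rightarrow> int \<Rightarrow> complex" where
  "herm_coeff a s = (if s = 0 then a 0 + cnj (a 0) else conj_ext a s)"

text \<open>Stated for arbitrary numbers \<open>x\<close> so that it applies both to the values
  \<open>w i z\<close> and to \<open>c\<close>.\<close>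

lemma sum_symmetrized_eq:
  assumes "x 0 \<in> \<real>"
  shows "(\<Sum>k\<le>n. a k * x k + cnj (a k * x k)) =
    (\<Sum>s = - int n..int n. herm_coeff a s * conj_ext x s)"
proof (induction n)
  case 0
  have "cnj (x 0) = x 0" using assms by (simp add: Reals_cnj_iff)
  then show ?case by (simp add: herm_coeff_def conj_ext_def algebra_simps)
next
  case (Suc n)
  have "{- int (Suc n)..int (Suc n)} = insert (int (Suc n)) (insert (- int (Suc n)) {- int n..int n})"
    by auto
  then have "(\<Sum>s = - int (Suc n)..int (Suc n). herm_coeff a s * conj_ext x s) =
    herm_coeff a (int (Suc n)) * conj_ext x (int (Suc n)) +
    (herm_coeff a (- int (Suc n)) * conj_ext x (- int (Suc n)) +
     (\<Sum>s = - int n..int n. herm_coeff a s * conj_ext x s))" by simp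
  also have "herm_coeff a (int (Suc n)) * conj_ext x (int (Suc n)) = a (Suc n) * x (Suc n)"
    by (simp add: herm_coeff_def conj_ext_def del: of_nat_Suc)
  also have "herm_coeff a (- int (Suc n)) * conj_ext x (- int (Suc n)) = cnj (a (Suc n) * x (Suc n))"
    by (simp add: herm_coeff_def conj_ext_def del: of_nat_Suc)
  finally show ?case using Suc.IH by (simp add: algebra_simps)
qed

text \<open>Extending \<open>\<beta> j k\<close> by zero outside \<open>{- j..k}\<close> gives all
  pairs the common range \<open>{- n..n}\<close>, after which the sums can be exchanged. As
  \<open>X\<close> is arbitrary, the same coefficients serve the functions and the numbers
  \<open>c\<close>.\<close>

lemma sum_product_coeffs_eq:
  fixes \<beta> :: "nat \<Rightarrow> nat \<Rightarrow> int \<Rightarrow> complex"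
  defines "e \<equiv> \<lambda>n b s. \<Sum>j\<le>n. \<Sum>k\<le>n. if s \<in> {- int j..int k} then cnj (b j) * b k * \<beta> j k s else 0"
  shows "(\<Sum>j\<le>n. \<Sum>k\<le>n. cnj (b j) * (\<Sum>s = - int j..int k. \<beta> j k s * X s) * b k) =
    (\<Sum>s = - int n..int n. e n b s * X s)"
proof -
  have "cnj (b j) * (\<Sum>s = - int j..int k. \<beta> j k s * X s) * b k =
      (\<Sum>s = - int n..int n. (if s \<in> {- int j..int k} then cnj (b j) * b k * \<beta> j k s else 0) * X s)"
    if "j \<le> n" "k \<le> n" for j k
  proof -
    have "cnj (b j) * (\<Sum>s = - int j..int k. \<beta> j k s * X s) * b k =
      (\<Sum>s = - int j..int k. cnj (b j) * b k * \<beta> j k s * X s)"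
      by (simp add: sum_distrib_left sum_distrib_right algebra_simps)
    also have "\<dots> = (\<Sum>s = - int n..int n. (if s \<in> {- int j..int k} then cnj (b j) * b k * \<beta> j k s else 0) * X s)"
      using that by (intro sum.mono_neutral_cong_left) auto
    finally show ?thesis .
  qed
  then have "(\<Sum>j\<le>n. \<Sum>k\<le>n. cnj (b j) * (\<Sum>s = - int j..int k. \<beta> j k s * X s) * b k) =
    (\<Sum>j\<le>n. \<Sum>k\<le>n. \<Sum>s = - int n..int n. (if s \<in> {- int j..int k} then cnj (b j) * b k * \<beta> j k s else 0) * X s)"
    by simp
  also have "\<dots> = (\<Sum>j\<le>n. \<Sum>s = - int n..int n. \<Sum>k\<le>n. (if s \<in> {- int j..int k} then cnj (b j) * b k * \<beta> j k s else 0) * X s)"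
    by (intro sum.cong refl sum.swap)
  also have "\<dots> = (\<Sum>s = - int n..int n. \<Sum>j\<le>n. \<Sum>k\<le>n. (if s \<in> {- int j..int k} then cnj (b j) * b k * \<beta> j k s else 0) * X s)"
    by (rule sum.swap)
  finally show ?thesis unfolding e_def by (simp add: sum_distrib_right)
qed

lemma cmod_sum_squared:
  fixes f :: "nat \<Rightarrow> complex"
  shows "complex_of_real ((cmod (\<Sum>k\<le>n. b k * f k))\<^sup>2) =
    (\<Sum>j\<le>n. \<Sum>k\<le>n. cnj (b j) * (cnj (f j) * f k) * b k)"
proof -
  have "complex_of_real ((cmod (\<Sum>k\<le>n. b k * f k))\<^sup>2) = cnj (\<Sum>k\<le>n. b k * f k) * (\<Sum>k\<le>n. b k * f k)"
    by (simp only: complex_norm_square mult.commute)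
  also have "\<dots> = (\<Sum>j\<le>n. \<Sum>k\<le>n. cnj (b j * f j) * (b k * f k))"
    by (simp only: cnj_sum sum_product)
  also have "\<dots> = (\<Sum>j\<le>n. \<Sum>k\<le>n. cnj (b j) * (cnj (f j) * f k) * b k)"
    by (intro sum.cong) (simp_all add: mult_ac)
  finally show ?thesis .
qed

lemma positive_seq_of_pos_semidef:
  assumes indep: "conj_independent w" and w0: "\<forall>z\<in>unit_circle. w 0 z = 1"
    and coeffs: "product_coeffs w \<beta>" and fact: "factorization_property w" and c0: "c 0 \<in> \<real>"
    and psd: "pos_semidef n (gen_toeplitz_entry \<beta> c)"
  shows "positive_seq w n c"
  unfolding positive_seq_def
proof (intro allI impI)
  fix a assume "\<forall>z\<in>unit_circle. 0 \<le> (\<Sum>k\<le>n. a k * w k z + cnj (a k * w k z))"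
  from fact[unfolded factorization_property_def, THEN spec, THEN spec, THEN mp, OF this]
  obtain b where b: "\<And>z. z \<in> unit_circle \<Longrightarrow> (\<Sum>k\<le>n. a k * w k z + cnj (a k * w k z)) =
    complex_of_real ((cmod (\<Sum>k\<le>n. b k * w k z))\<^sup>2)"
    by blast
  let ?e = "\<lambda>s. \<Sum>j\<le>n. \<Sum>k\<le>n. if s \<in> {- int j..int k} then cnj (b j) * b k * \<beta> j k s else 0"
  \<comment> \<open>Both sides are coefficients of one function on the circle, the symmetrized sum
    and the expanded square, so independence identifies them.\<close>
  have eq: "herm_coeff a s = ?e s" if "s \<in> {- int n..int n}" for s
  proof (rule conj_independent_coeffs_eq[where d = "herm_coeff a" and e = ?e, OF indep _ _ that])
    fix z assume z: "z \<in> unit_circle"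
    have "(\<Sum>s = - int n..int n. herm_coeff a s * conj_ext (\<lambda>i. w i z) s) =
      (\<Sum>k\<le>n. a k * w k z + cnj (a k * w k z))"
      using w0 z by (intro sum_symmetrized_eq[of "\<lambda>i. w i z", symmetric]) simp
    also have "\<dots> = (\<Sum>j\<le>n. \<Sum>k\<le>n. cnj (b j) * (cnj (w j z) * w k z) * b k)"
      by (simp only: b[OF z] cmod_sum_squared)
    also have "\<dots> = (\<Sum>j\<le>n. \<Sum>k\<le>n. cnj (b j) *
        (\<Sum>s = - int j..int k. \<beta> j k s * conj_ext (\<lambda>i. w i z) s) * b k)"
      by (simp only: bspec[OF coeffs[unfolded product_coeffs_def, THEN spec, THEN spec] z])
    also have "\<dots> = (\<Sum>s = - int n..int n. ?e s * conj_ext (\<lambda>i. w i z) s)"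
      unfolding sum_product_coeffs_eq ..
    finally show "(\<Sum>s = - int n..int n. herm_coeff a s * conj_ext (\<lambda>i. w i z) s) =
      (\<Sum>s = - int n..int n. ?e s * conj_ext (\<lambda>i. w i z) s)" .
  qed simp
  \<comment> \<open>The same two expansions are now evaluated at \<open>c\<close> in place of the
    functions.\<close>
  have "(\<Sum>k\<le>n. a k * c k + cnj (a k * c k)) = (\<Sum>s = - int n..int n. herm_coeff a s * conj_ext c s)"
    by (rule sum_symmetrized_eq[of c, OF c0])
  also have "\<dots> = (\<Sum>s = - int n..int n. ?e s * conj_ext c s)"
    by (intro sum.cong refl) (simp only: eq)
  also have "\<dots> = (\<Sum>j\<le>n. \<Sum>k\<le>n. cnj (b j) * gen_toeplitz_entry \<beta> c j k * b k)"
    unfolding gen_toeplitz_entry_def sum_product_coeffs_eq ..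
  also have "\<dots> \<ge> 0" using psd unfolding pos_semidef_def by (elim conjE allE)
  finally show "0 \<le> (\<Sum>k\<le>n. a k * c k + cnj (a k * c k))" .
qed

section \<open>From a representing measure to the matrix and its positivity\<close>

lemma gen_toeplitz_entry_integral:
  assumes cont: "\<And>k. continuous_on unit_circle (w k)" and coeffs: "product_coeffs w \<beta>"
    and \<sigma>: "finite_circle_measure \<sigma>" and c: "\<And>k. k \<le> n \<Longrightarrow> c k = (\<integral>z. w k z \<partial>\<sigma>)"
    and jk: "j \<le> n" "k \<le> n"
  shows "gen_toeplitz_entry \<beta> c j k = (\<integral>z. cnj (w j z) * w k z \<partial>\<sigma>)"
proof -
  have int: "integrable \<sigma> (\<lambda>z. conj_ext (\<lambda>i. w i z) s)" for s
    using cont by (intro integrable_finite_circle_measure[OF \<sigma>])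
      (cases "0 \<le> s"; simp add: conj_ext_def continuous_intros)
  have "(\<integral>z. cnj (w j z) * w k z \<partial>\<sigma>) =
    (\<integral>z. (\<Sum>s = - int j..int k. \<beta> j k s * conj_ext (\<lambda>i. w i z) s) \<partial>\<sigma>)"
    using coeffs by (intro Bochner_Integration.integral_cong)
      (auto simp: product_coeffs_def space_finite_circle_measure[OF \<sigma>])
  also have "\<dots> = (\<Sum>s = - int j..int k. \<beta> j k s * (\<integral>z. conj_ext (\<lambda>i. w i z) s \<partial>\<sigma>))"
    using int by (subst Bochner_Integration.integral_sum) auto
  \<comment> \<open>Every \<open>s\<close> here has absolute value at most \<open>n\<close>, so
    \<open>c\<close> is given by the integrals; negative indices follow because integration commutes
    with conjugation.\<close>
  also have "\<dots> = (\<Sum>s = - int j..int k. \<beta> j k s * conj_ext c s)"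
    using c jk by (intro sum.cong) (auto simp: conj_ext_def)
  finally show ?thesis by (simp add: gen_toeplitz_entry_def)
qed

lemma pos_semidef_integral:
  assumes cont: "\<And>k. continuous_on unit_circle (w k)" and \<sigma>: "finite_circle_measure \<sigma>"
    and A: "\<And>j k. j \<le> n \<Longrightarrow> k \<le> n \<Longrightarrow> A j k = (\<integral>z. cnj (w j z) * w k z \<partial>\<sigma>)"
  shows "pos_semidef n A"
  unfolding pos_semidef_def
proof (intro conjI allI impI)
  fix j k assume "j \<le> n" "k \<le> n"
  then show "A k j = cnj (A j k)"
    by (simp add: A mult.commute flip: Bochner_Integration.integral_cnj)
next
  fix x :: "nat \<Rightarrow> complex"
  have int: "integrable \<sigma> (\<lambda>z. cnj (w j z) * w k z)" for j k
    using cont by (intro integrable_finite_circle_measure[OF \<sigma>] continuous_intros)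
  have "(\<Sum>j\<le>n. \<Sum>k\<le>n. cnj (x j) * A j k * x k) =
    (\<integral>z. (\<Sum>j\<le>n. \<Sum>k\<le>n. cnj (x j) * (cnj (w j z) * w k z) * x k) \<partial>\<sigma>)"
    using int by (simp add: A Bochner_Integration.integral_sum)
  also have "\<dots> = of_real (\<integral>z. (cmod (\<Sum>k\<le>n. x k * w k z))\<^sup>2 \<partial>\<sigma>)"
    unfolding cmod_sum_squared[symmetric] by (rule integral_complex_of_real)
  also have "\<dots> \<ge> 0" by (simp add: less_eq_complex_def)
  finally show "0 \<le> (\<Sum>j\<le>n. \<Sum>k\<le>n. cnj (x j) * A j k * x k)" .
qed

section \<open>Existence of a representing measure for a positive sequence\<close>

lemma representing_measure_of_positive_seq:
  assumes cont: "\<And>k. continuous_on unit_circle (w k)"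
    and w0: "\<forall>z\<in>unit_circle. w 0 z = 1" and c: "positive_seq w n c"
  shows "\<exists>\<sigma>. finite_circle_measure \<sigma> \<and> (\<forall>k\<le>n. c k = (\<integral>z. w k z \<partial>\<sigma>))"
proof -
  let ?I = "{..n} <+> {..n}"
  \<comment> \<open>The curve in complex space of dimension \<open>n + 1\<close> is read in real
    coordinates, \<open>Inl\<close> for real and \<open>Inr\<close> for imaginary parts. Coordinate
    \<open>Inl 0\<close> is the constant 1 by (P1).\<close>
  define v :: "nat + nat \<Rightarrow> complex \<Rightarrow> real"
    where "v i z = (case i of Inl k \<Rightarrow> Re (w k z) | Inr k \<Rightarrow> Im (w k z))" for i z
  define x :: "nat + nat \<Rightarrow> real"
    where "x i = (case i of Inl k \<Rightarrow> Re (c k) | Inr k \<Rightarrow> Im (c k))" for i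
  have "\<exists>(N::nat) t p. (\<forall>l. 0 \<le> t l \<and> p l \<in> unit_circle) \<and>
    (\<forall>i\<in>?I. x i = (\<Sum>l\<le>N. t l * v i (p l)))"
  proof (rule conic_combination_of_positive[where ?i0.0 = "Inl 0"])
    show "continuous_on unit_circle (v i)" for i
      unfolding v_def using cont by (cases i) (auto intro!: continuous_intros)
    show "v (Inl 0) z = 1" if "z \<in> unit_circle" for z using that w0 by (simp add: v_def)
    fix a :: "nat + nat \<Rightarrow> real"
    assume pos: "\<And>z. z \<in> unit_circle \<Longrightarrow> 0 \<le> (\<Sum>i\<in>?I. a i * v i z)"
    \<comment> \<open>The minus sign makes the real part of \<open>a' k * y\<close> equal to
      \<open>a (Inl k) * Re y + a (Inr k) * Im y\<close>. The symmetrized sum is then twice the real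
      functional, and the two notions of positivity agree.\<close>
    define a' where "a' k = Complex (a (Inl k)) (- a (Inr k))" for k
    have term_eq: "a' k * y + cnj (a' k * y) =
        complex_of_real (2 * (a (Inl k) * Re y + a (Inr k) * Im y))" for k y
      by (simp add: a'_def complex_eq_iff)
    have "(\<Sum>k\<le>n. a' k * w k z + cnj (a' k * w k z)) = complex_of_real (2 * (\<Sum>i\<in>?I. a i * v i z))" for z
      by (simp only: term_eq sum.Plus[OF finite_atMost finite_atMost] v_def sum.case
          sum.distrib sum_distrib_left of_real_sum[symmetric] distrib_left o_def)
    then have nonneg: "0 \<le> (\<Sum>k\<le>n. a' k * c k + cnj (a' k * c k))"
      using c[unfolded positive_seq_def, rule_format, of a'] pos by (simp add: less_eq_complex_def)
    have value_eq: "(\<Sum>k\<le>n. a' k * c k + cnj (a' k * c k)) = complex_of_real (2 * (\<Sum>i\<in>?I. a i * x i))"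
      by (simp only: term_eq sum.Plus[OF finite_atMost finite_atMost] x_def sum.case
          sum.distrib sum_distrib_left of_real_sum[symmetric] distrib_left o_def)
    from nonneg show "0 \<le> (\<Sum>i\<in>?I. a i * x i)"
      unfolding value_eq less_eq_complex_def Re_complex_of_real by simp
  qed auto
  then obtain N :: nat and t p where tp: "\<And>l. 0 \<le> t l" "\<And>l. p l \<in> unit_circle"
    and x: "\<And>i. i \<in> ?I \<Longrightarrow> x i = (\<Sum>l\<le>N. t l * v i (p l))" by blast
  obtain \<sigma> where \<sigma>: "finite_circle_measure \<sigma>"
    "\<And>f. continuous_on unit_circle f \<Longrightarrow> (\<integral>z. f z \<partial>\<sigma>) = (\<Sum>l\<le>N. of_real (t l) * f (p l) :: complex)"
    using discrete_circle_measure[of t p N] tp by blast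
  have "c k = (\<integral>z. w k z \<partial>\<sigma>)" if "k \<le> n" for k
    using x[OF InlI, of k] x[OF InrI, of k] that
    by (simp add: \<sigma>(2)[OF cont] complex_eq_iff x_def v_def)
  with \<sigma>(1) show ?thesis by blast
qed

theorem theorem1p1:
  fixes w :: "nat \<Rightarrow> complex \<Rightarrow> complex"
    and \<beta> :: "nat \<Rightarrow> nat \<Rightarrow> int \<Rightarrow> complex"
    and n :: nat
    and c :: "nat \<Rightarrow> complex"
  assumes continuous: "\<And>k. continuous_on unit_circle (w k)"
    and independent: "conj_independent w"
    and P1: "\<forall>z\<in>unit_circle. w 0 z = 1"
    and P2: "product_property w"
    and P2_coeffs: "product_coeffs w \<beta>"
    and P3: "factorization_property w"
    and c0_real: "c 0 \<in> \<real>"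
  shows "(pos_semidef n (gen_toeplitz_entry \<beta> c) \<longleftrightarrow> positive_seq w n c) \<and>
    (positive_seq w n c \<longleftrightarrow>
      (\<exists>\<sigma>. finite_circle_measure \<sigma> \<and>
        (\<forall>j\<le>n. \<forall>k\<le>n. gen_toeplitz_entry \<beta> c j k = (\<integral>z. cnj (w j z) * w k z \<partial>\<sigma>)))) \<and>
    ((\<exists>\<sigma>. finite_circle_measure \<sigma> \<and>
        (\<forall>j\<le>n. \<forall>k\<le>n. gen_toeplitz_entry \<beta> c j k = (\<integral>z. cnj (w j z) * w k z \<partial>\<sigma>))) \<longleftrightarrow>
      (\<exists>\<sigma>. finite_circle_measure \<sigma> \<and> (\<forall>k\<le>n. c k = (\<integral>z. w k z \<partial>\<sigma>))))"
proof -
  let ?E = "gen_toeplitz_entry \<beta> c"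
  let ?pos = "positive_seq w n c" and ?psd = "pos_semidef n ?E"
  let ?m2 = "\<exists>\<sigma>. finite_circle_measure \<sigma> \<and>
    (\<forall>j\<le>n. \<forall>k\<le>n. ?E j k = (\<integral>z. cnj (w j z) * w k z \<partial>\<sigma>))"
  let ?m1 = "\<exists>\<sigma>. finite_circle_measure \<sigma> \<and> (\<forall>k\<le>n. c k = (\<integral>z. w k z \<partial>\<sigma>))"
  have "?psd \<Longrightarrow> ?pos"
    by (rule positive_seq_of_pos_semidef[OF independent P1 P2_coeffs P3]) (use c0_real in simp_all)
  moreover have "?pos \<Longrightarrow> ?m1" by (rule representing_measure_of_positive_seq[where w = w, OF continuous P1])
  moreover have "?m1 \<Longrightarrow> ?m2" using gen_toeplitz_entry_integral[where w = w and c = c and n = n, OF continuous P2_coeffs] by blast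
  moreover have "?m2 \<Longrightarrow> ?psd" using pos_semidef_integral[where w = w, OF continuous] by blast
  ultimately show ?thesis by argo
qed

end
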